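(* The Apéry limit $$\lim_{n\to\infty}\frac{B_n^{(8)}}{s_n}=\frac{7}{32}\zeta(3)$$ is equivalent, via a continuant transformation, to the continued fraction $$\mathrm{PCF}\bigl((2n+1)(3n^2+3n+1),-n^6\bigr)=\frac{8}{7\zeta(3)},$$ which appears explicitly in work of Batut and Olivier and was later rediscovered by the Ramanujan Machine and listed there as conjecture Z1.
   Context: For polynomial sequences $(a_n)_{n\ge 0}$, $(b_n)_{n\ge 1}$, $$\mathrm{PCF}(a_n,b_n):=a_0+\cfrac{b_1}{a_1+\cfrac{b_2}{a_2+\cfrac{b_3}{a_3+\ddots}}},$$ i.e. the limit of the convergents; here $a_n=(2n+1)(3n^2+3n+1)$ (so $a_0=1$) and $b_n=-n^6$. The sequence $s_n$ is $s_n=\sum_{k=0}^n\binom{n}{k}^2\binom{2k}{n}^2$ for $n\ge 0$, and $(B_n^{(8)})_{n\ge 0}$ is the rational sequence with $B_0^{(8)}=0$, $B_1^{(8)}=1$ and $(n+1)^3B^{(8)}_{n+1}=(2n+1)(12n^2+12n+4)B^{(8)}_n-16n^3B^{(8)}_{n-1}$ for $n\ge 1$. $\zeta$ is the Riemann zeta function. The continuants $P_n,Q_n$ of the continued fraction are given by $U_n=a_nU_{n-1}+b_nU_{n-2}$ $(n\ge 1)$ for $U=P,Q$, with $P_{-1}=P_0=1$, $Q_{-1}=0$, $Q_0=1$, so that $P_n/Q_n$ is the $n$th convergent; the continuant transformation is the rescaling $P_n=\frac{(n+1)!^3}{4^{n+1}}s_{n+1}$, $Q_n=\frac{(n+1)!^3}{4^n}B^{(8)}_{n+1}$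 $(n\ge 0)$ relating the two sequences to these continuants. *)

theory Defs
  imports Complex_Main
begin

text \<open>
  Finite continued fraction \<open>a\<^sub>k + b\<^sub>k\<^sub>+\<^sub>1 / (a\<^sub>k\<^sub>+\<^sub>1 + \<dots> + b\<^sub>k\<^sub>+\<^sub>n / a\<^sub>k\<^sub>+\<^sub>n)\<close>.
  If an inner denominator vanishes, the convention \<open>x / 0 = 0\<close> applies; this never
  happens for the coefficients \<open>pcf_a\<close> and \<open>pcf_b\<close> below.
\<close>

fun cf_from :: "(nat \<Rightarrow> real) \<Rightarrow> (nat \<Rightarrow> real) \<Rightarrow> nat \<Rightarrow> nat \<Rightarrow> real" where
  "cf_from a b k 0 = a k"
| "cf_from a b k (Suc n) = a k + b (Suc k) / cf_from a b (Suc k) n"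

definition cf_convergent :: "(nat \<Rightarrow> real) \<Rightarrow> (nat \<Rightarrow> real) \<Rightarrow> nat \<Rightarrow> real" where
  "cf_convergent a b n = cf_from a b 0 n"

text \<open>
  \<open>has_PCF a b L\<close> means \<open>PCF(a\<^sub>n, b\<^sub>n) = L\<close>, including that the convergents do converge.
  The value \<open>b 0\<close> is not used.
\<close>

definition has_PCF :: "(nat \<Rightarrow> real) \<Rightarrow> (nat \<Rightarrow> real) \<Rightarrow> real \<Rightarrow> bool" where
  "has_PCF a b L \<longleftrightarrow> cf_convergent a b \<longlonglongrightarrow> L"

text \<open>
  The solution of \<open>U\<^sub>n = a\<^sub>n U\<^sub>n\<^sub>-\<^sub>1 + b\<^sub>n U\<^sub>n\<^sub>-\<^sub>2\<close> for \<open>n \<ge> 1\<close> with \<open>U\<^sub>-\<^sub>1 = u\<close> and \<open>U\<^sub>0 = v\<close>;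
  the index \<open>-1\<close> is eliminated by unfolding the recurrence once at \<open>n = 1\<close>.
\<close>

fun continuant :: "(nat \<Rightarrow> real) \<Rightarrow> (nat \<Rightarrow> real) \<Rightarrow> real \<Rightarrow> real \<Rightarrow> nat \<Rightarrow> real" where
  "continuant a b u v 0 = v"
| "continuant a b u v (Suc 0) = a 1 * v + b 1 * u"
| "continuant a b u v (Suc (Suc n)) =
     a (n + 2) * continuant a b u v (Suc n) + b (n + 2) * continuant a b u v n"

definition pcf_a :: "nat \<Rightarrow> real" where
  "pcf_a n = (2 * real n + 1) * (3 * real n ^ 2 + 3 * real n + 1)"

definition pcf_b :: "nat \<Rightarrow> real" where
  "pcf_b n = - (real n ^ 6)"

definition P :: "nat \<Rightarrow> real" where
  "P = continuant pcf_a pcf_b 1 1"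

definition Q :: "nat \<Rightarrow> real" where
  "Q = continuant pcf_a pcf_b 0 1"

definition s :: "nat \<Rightarrow> nat" where
  "s n = (\<Sum>k=0..n. (n choose k)\<^sup>2 * ((2 * k) choose n)\<^sup>2)"

text \<open>
  The recurrence \<open>(m+1)\<^sup>3 B\<^sub>m\<^sub>+\<^sub>1 = (2m+1)(12m\<^sup>2+12m+4) B\<^sub>m - 16m\<^sup>3 B\<^sub>m\<^sub>-\<^sub>1\<close> at \<open>m = n + 1\<close>,
  solved for \<open>B\<^sub>m\<^sub>+\<^sub>1\<close>.
\<close>

fun B8 :: "nat \<Rightarrow> real" where
  "B8 0 = 0"
| "B8 (Suc 0) = 1"
| "B8 (Suc (Suc n)) =
     (let m = real (Suc n) in
       ((2 * m + 1) * (12 * m ^ 2 + 12 * m + 4) * B8 (Suc n) - 16 * m ^ 3 * B8 n) / (m + 1) ^ 3)"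

text \<open>The Riemann zeta function on real arguments \<open>x > 1\<close>, by its Dirichlet series.\<close>

definition zeta :: "real \<Rightarrow> real" where
  "zeta x = (\<Sum>n. 1 / real (Suc n) powr x)"

end

theory Submission
  imports Defs "HOL-Analysis.Gamma_Function"
begin

text \<open>
  The scaled sequences satisfy the continuant recurrence because \<open>s\<close> satisfies the same
  three-term recurrence as \<open>B8\<close>. That recurrence comes from Zeilberger's algorithm: applied to
  the summand \<open>F n k = (n choose k)\<^sup>2 (2k choose n)\<^sup>2\<close>, the recurrence operator
  yields a difference \<open>G n (k + 1) - G n k\<close>, where \<open>G\<close> is a rational multiple of \<open>F\<close>. Writing
  \<open>F\<close> through the entire function \<open>1 / \<Gamma>\<close> makes the certificate identity hold for all \<open>k\<close>,
  without boundary cases. The convergents are \<open>P n / Q n\<close> since no tail of the continued fraction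
  vanishes (the tail starting at \<open>k\<close> is at least \<open>k\<^sup>3\<close>), and the two limits are the reciprocals
  of one another up to a factor 4.
\<close>

section \<open>Continuants and convergents\<close>

text \<open>The recurrence sees only two predecessors, so the values at 0 and 1 can serve as those
  at -1 and 0 for the shifted coefficients. This peels off the outermost level of a continued
  fraction.\<close>

lemma continuant_Suc_shift:
  "continuant a b u v (Suc n) =
     continuant (\<lambda>i. a (Suc i)) (\<lambda>i. b (Suc i)) v (a 1 * v + b 1 * u) n"
proof (induction n rule: induct_nat_012)
  case 1
  then show ?case by (simp add: numeral_2_eq_2)
next
  case (ge2 n)
  then show ?case by simp
qed simp

lemma continuant_linear:
  "continuant a b (c * u + d * u') (c * v + d * v') n =
     c * continuant a b u v n + d * continuant a b u' v' n"
  by (induction n rule: induct_nat_012) (simp_all add: algebra_simps)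

text \<open>If the tail from \<open>Suc k\<close> is \<open>N / D\<close>, shift and linearity give
  the new denominator \<open>N\<close> and numerator \<open>a k * N + b (Suc k) * D\<close>. Nonzero
  tails keep the convention \<open>x / 0 = 0\<close> out of play.\<close>

lemma cf_from_eq_continuants:
  assumes "\<And>j m. j > k \<Longrightarrow> cf_from a b j m \<noteq> 0"
  shows "cf_from a b k n =
           continuant (\<lambda>i. a (k + i)) (\<lambda>i. b (k + i)) 1 (a k) n /
           continuant (\<lambda>i. a (k + i)) (\<lambda>i. b (k + i)) 0 1 n"
  using assms
proof (induction n arbitrary: k)
  case (Suc n)
  define N where "N = continuant (\<lambda>i. a (Suc k + i)) (\<lambda>i. b (Suc k + i)) 1 (a (Suc k)) n"
  define D where "D = continuant (\<lambda>i. a (Suc k + i)) (\<lambda>i. b (Suc k + i)) 0 1 n"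
  have tail: "cf_from a b (Suc k) n = N / D"
    using Suc.IH[of "Suc k"] Suc.prems by (simp add: N_def D_def)
  moreover have "cf_from a b (Suc k) n \<noteq> 0"
    using Suc.prems by simp
  ultimately have "N \<noteq> 0" "D \<noteq> 0" by auto
  have "continuant (\<lambda>i. a (k + i)) (\<lambda>i. b (k + i)) 0 1 (Suc n) = N"
    by (simp add: continuant_Suc_shift N_def)
  moreover have "continuant (\<lambda>i. a (k + i)) (\<lambda>i. b (k + i)) 1 (a k) (Suc n)
      = a k * N + b (Suc k) * D"
    using continuant_linear[of "\<lambda>i. a (Suc k + i)" "\<lambda>i. b (Suc k + i)"
        "a k" 1 "b (Suc k)" 0 "a (Suc k)" 1 n]
    by (simp add: continuant_Suc_shift N_def D_def mult.commute)
  ultimately show ?case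
    using tail \<open>N \<noteq> 0\<close> by (simp add: field_simps)
qed simp

text \<open>If the next tail is at least (k+1)^3, then (k+1)^6 divided by it is at most (k+1)^3, and
  \<open>pcf_a k\<close> - (k+1)^3 = 5k^3 + 6k^2 + 2k.\<close>

lemma cf_from_pcf_ge: "cf_from pcf_a pcf_b k n \<ge> real k ^ 3"
proof (induction n arbitrary: k)
  case 0
  show ?case by (simp add: pcf_a_def algebra_simps power2_eq_square power3_eq_cube)
next
  case (Suc n)
  have "real (Suc k) ^ 6 / cf_from pcf_a pcf_b (Suc k) n \<le> real (Suc k) ^ 6 / real (Suc k) ^ 3"
    using Suc.IH[of "Suc k"]
    by (intro divide_left_mono mult_pos_pos less_le_trans[OF _ Suc.IH[of "Suc k"]]) simp_all
  also have "\<dots> = real (Suc k) ^ 3"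
    by (simp add: field_simps flip: power_add)
  finally have "cf_from pcf_a pcf_b k (Suc n) \<ge> pcf_a k - real (Suc k) ^ 3"
    by (simp add: pcf_b_def)
  moreover have "pcf_a k - real (Suc k) ^ 3 \<ge> real k ^ 3"
    by (simp add: pcf_a_def algebra_simps power2_eq_square power3_eq_cube)
  ultimately show ?case by linarith
qed

lemma cf_convergent_pcf: "cf_convergent pcf_a pcf_b n = P n / Q n"
proof -
  have "cf_from pcf_a pcf_b j m \<noteq> 0" if "j > 0" for j m
    using cf_from_pcf_ge[of j m] that by (smt (verit) of_nat_0_less_iff zero_less_power)
  then show ?thesis
    using cf_from_eq_continuants[of 0 pcf_a pcf_b n]
    by (simp add: cf_convergent_def P_def Q_def pcf_a_def[of 0])
qed

section \<open>The recurrence of \<open>s\<close>\<close>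

text \<open>In the product of the two binomials n! cancels, leaving (2k)! / (k! (n-k)! (2k-n)!).
  Since \<open>rGamma\<close> is 0 at nonpositive integers, it also vanishes where a binomial
  does.\<close>

definition s_summand :: "real \<Rightarrow> nat \<Rightarrow> real" where
  "s_summand x k =
     (fact (2 * k) / fact k * rGamma (x - real k + 1) * rGamma (2 * real k - x + 1))\<^sup>2"

lemma s_summand_nat: "s_summand (real n) k = real ((n choose k)\<^sup>2 * ((2 * k) choose n)\<^sup>2)"
proof -
  have rG: "rGamma (real i - real j + 1) = (if j \<le> i then 1 / fact (i - j) else 0)" for i j :: nat
  proof -
    have "real i - real j + 1 = of_int (int i - int j + 1)" by simp
    then have "rGamma (real i - real j + 1) =
        (if int i - int j + 1 > 0 then inverse (fact (nat (int i - int j))) else 0)"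
      using rGamma_of_int[of "int i - int j + 1", where ?'a = real] by (simp only: add_diff_cancel)
    moreover have "nat (int i - int j) = i - j" by linarith
    ultimately show ?thesis by (simp only: inverse_eq_divide) force
  qed
  have "fact (2 * k) / fact k * rGamma (real n - real k + 1) * rGamma (real (2 * k) - real n + 1)
      = real (n choose k) * real ((2 * k) choose n)"
    unfolding rG by (auto simp: binomial_fact)
  then show ?thesis
    unfolding s_summand_def by (simp add: power_mult_distrib)
qed

text \<open>
  The polynomial factor of degree 5 solves Gosper's equation for the recurrence operator of
  \<open>s\<close>; it was found by linear algebra.
\<close>

definition s_cert_poly :: "real \<Rightarrow> real \<Rightarrow> real" where
  "s_cert_poly x y =
     12 * y^2 - 32 * y^3 + 16 * y^4
     + x * (- 12 * y + 84 * y^2 - 112 * y^3 + 32 * y^4)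
     + x^2 * (3 - 60 * y + 168 * y^2 - 96 * y^3)
     + x^3 * (13 - 92 * y + 100 * y^2) + x^4 * (17 - 44 * y) + 7 * x^5"

text \<open>This is the summand times \<open>s_cert_poly\<close> / (x-k+1)^2, with the pole at k =
  x+1 absorbed into \<open>rGamma (x - real k + 2)\<close>.\<close>

definition s_cert :: "real \<Rightarrow> nat \<Rightarrow> real" where
  "s_cert x k =
     (fact (2 * k) / fact k * rGamma (x - real k + 2) * rGamma (2 * real k - x + 3)
        * (2 * real k - x + 1) * (2 * real k - x + 2))\<^sup>2 * s_cert_poly x (real k)"

text \<open>By 1/Gamma(z) = z/Gamma(z+1), all five terms are polynomial multiples of
  \<open>(C * A * B)\<^sup>2\<close>; the identity \<open>poly\<close> between the cofactors
  remains.\<close>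

lemma s_cert_telescopes:
  "(x + 1)^3 * s_summand (x + 1) k - (2 * x + 1) * (12 * x^2 + 12 * x + 4) * s_summand x k
     + 16 * x^3 * s_summand (x - 1) k = s_cert x (Suc k) - s_cert x k"
proof -
  define y where "y = real k"
  define C :: real where "C = fact (2 * k) / fact k"
  define A where "A = rGamma (x - y + 2)"
  define B where "B = rGamma (2 * y - x + 3)"
  have C': "fact (2 * Suc k) / fact (Suc k) = 2 * (2 * y + 1) * C"
  proof -
    have "fact (2 * Suc k) = (y + 1) * (2 * (2 * y + 1) * fact (2 * k))"
      and "fact (Suc k) = (y + 1) * (fact k :: real)" and "y + 1 \<noteq> 0"
      by (simp_all add: y_def algebra_simps)
    then show ?thesis
      by (simp only: C_def mult_divide_mult_cancel_left times_divide_eq_right not_False_eq_True)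
  qed
  have A1: "rGamma (x - y + 1) = (x - y + 1) * A"
    using rGamma_plus1[of "x - y + 1"] by (simp add: A_def add.assoc)
  have A0: "rGamma (x - y) = (x - y) * (x - y + 1) * A"
    using rGamma_plus1[of "x - y"] by (simp add: A1)
  have B2: "rGamma (2 * y - x + 2) = (2 * y - x + 2) * B"
    using rGamma_plus1[of "2 * y - x + 2"] by (simp add: B_def add.assoc)
  have B1: "rGamma (2 * y - x + 1) = (2 * y - x + 1) * (2 * y - x + 2) * B"
    using rGamma_plus1[of "2 * y - x + 1"] by (simp add: B2 add.assoc)
  have B0: "rGamma (2 * y - x) = (2 * y - x) * (2 * y - x + 1) * (2 * y - x + 2) * B"
    using rGamma_plus1[of "2 * y - x"] by (simp add: B1)
  \<comment> \<open>Only the certificate at \<open>Suc k\<close> reaches beyond \<open>B\<close>;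
    its two linear factors bring it back.\<close>
  have B4: "rGamma (2 * y - x + 5) * (2 * y - x + 3) * (2 * y - x + 4) = B"
    using rGamma_plus1[of "2 * y - x + 4"] rGamma_plus1[of "2 * y - x + 3"]
    by (simp add: B_def add.assoc mult_ac)
  \<comment> \<open>The factor \<open>1\<close> gives this term the shape that \<open>pull\<close>
    expects.\<close>
  have F1: "s_summand (x + 1) k = (C * (1 * A) * ((2 * y - x) * (2 * y - x + 1) * (2 * y - x + 2) * B))\<^sup>2"
  proof -
    have "x + 1 - y + 1 = x - y + 2" "2 * y - (x + 1) + 1 = 2 * y - x" by simp_all
    then show ?thesis
      unfolding s_summand_def C_def[symmetric] y_def[symmetric] by (simp only: B0 A_def mult_1)
  qed
  have F0: "s_summand x k
      = (C * ((x - y + 1) * A) * ((2 * y - x + 1) * (2 * y - x + 2) * B))\<^sup>2"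
    unfolding s_summand_def C_def[symmetric] y_def[symmetric] A1 B1 ..
  have Fm: "s_summand (x - 1) k
      = (C * ((x - y) * (x - y + 1) * A) * ((2 * y - x + 2) * B))\<^sup>2"
  proof -
    have "x - 1 - y + 1 = x - y" "2 * y - (x - 1) + 1 = 2 * y - x + 2" by simp_all
    then show ?thesis
      unfolding s_summand_def C_def[symmetric] y_def[symmetric] by (simp only: A0 B2)
  qed
  have sq: "fact (2 * Suc k) / fact (Suc k) * rGamma (x - real (Suc k) + 2)
        * rGamma (2 * real (Suc k) - x + 3) * (2 * real (Suc k) - x + 1) * (2 * real (Suc k) - x + 2)
      = 2 * (2 * y + 1) * C * ((x - y + 1) * A) * B"
  proof -
    have "x - real (Suc k) + 2 = x - y + 1" "2 * real (Suc k) - x + 3 = 2 * y - x + 5"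
      "2 * real (Suc k) - x + 1 = 2 * y - x + 3" "2 * real (Suc k) - x + 2 = 2 * y - x + 4"
      by (simp_all add: y_def)
    then show ?thesis
      unfolding C' by (simp only: A1 mult.assoc flip: B4)
  qed
  have y': "real (Suc k) = y + 1" by (simp add: y_def)
  have poly: "(x + 1)^3 * ((2 * y - x) * (2 * y - x + 1) * (2 * y - x + 2))\<^sup>2
      - (2 * x + 1) * (12 * x^2 + 12 * x + 4) * ((x - y + 1) * (2 * y - x + 1) * (2 * y - x + 2))\<^sup>2
      + 16 * x^3 * ((x - y) * (x - y + 1) * (2 * y - x + 2))\<^sup>2
    = (2 * (2 * y + 1) * (x - y + 1))\<^sup>2 * s_cert_poly x (y + 1)
      - ((2 * y - x + 1) * (2 * y - x + 2))\<^sup>2 * s_cert_poly x y"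
    unfolding s_cert_poly_def by algebra
  have pull: "(C * (u * A) * (v * B))\<^sup>2 = (C * A * B)\<^sup>2 * (u * v)\<^sup>2" for u v
    by (simp add: power_mult_distrib mult_ac)
  have factor: "a * (t * p) - b * (t * q) + c * (t * r) = t * (a * p - b * q + c * r)"
    for a b c p q r t :: real
    by (simp add: algebra_simps)
  have "s_cert x k = (C * A * B)\<^sup>2 * (((2 * y - x + 1) * (2 * y - x + 2))\<^sup>2 * s_cert_poly x y)"
    unfolding s_cert_def C_def[symmetric] y_def[symmetric] A_def[symmetric] B_def[symmetric]
    by (simp add: power_mult_distrib mult_ac)
  moreover have "s_cert x (Suc k)
      = (C * A * B)\<^sup>2 * ((2 * (2 * y + 1) * (x - y + 1))\<^sup>2 * s_cert_poly x (y + 1))"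
    unfolding s_cert_def sq unfolding y' by (simp add: power_mult_distrib mult_ac)
  ultimately have "s_cert x (Suc k) - s_cert x k = (C * A * B)\<^sup>2 *
      ((2 * (2 * y + 1) * (x - y + 1))\<^sup>2 * s_cert_poly x (y + 1)
        - ((2 * y - x + 1) * (2 * y - x + 2))\<^sup>2 * s_cert_poly x y)"
    by (simp only: right_diff_distrib)
  then show ?thesis
    unfolding F1 F0 Fm pull factor poly[symmetric] by (simp only: mult.assoc mult_1)
qed

text \<open>The extra terms vanish, which lets the sums for n-1, n and n+1 share one range.\<close>

lemma s_eq_sum_summand:
  assumes "n \<le> N"
  shows "real (s n) = (\<Sum>k\<le>N. s_summand (real n) k)"
proof -
  have "real (s n) = (\<Sum>k\<le>n. s_summand (real n) k)"
    by (simp add: s_def s_summand_nat atMost_atLeast0)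
  also have "\<dots> = (\<Sum>k\<le>N. s_summand (real n) k)"
    using assms by (intro sum.mono_neutral_left) (auto simp: s_summand_nat binomial_eq_0)
  finally show ?thesis .
qed

text \<open>Summing the certificate identity over k \<le> n+1 leaves only the boundary values at 0
  and n+2, both zero.\<close>

lemma s_recurrence:
  assumes "n > 0"
  shows "(real n + 1)^3 * real (s (n + 1)) =
     (2 * real n + 1) * (12 * real n^2 + 12 * real n + 4) * real (s n)
     - 16 * real n^3 * real (s (n - 1))"
proof -
  define x where "x = real n"
  have "s_cert x 0 = 0"
  proof -
    \<comment> \<open>At k = 0 the linear factors are 1-n and 2-n, which settle n = 1 and n = 2;
      from n = 3 on, \<open>rGamma (3 - x)\<close> is zero.\<close>
    consider "n = 1" | "n = 2" | "n \<ge> 3" using assms by linarith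
    then show ?thesis
    proof cases
      case 3
      have "rGamma (3 - x) = rGamma (of_int (3 - int n))" by (simp add: x_def)
      also have "\<dots> = 0" using 3 by (subst rGamma_of_int) auto
      finally show ?thesis by (simp add: s_cert_def)
    qed (simp_all add: s_cert_def x_def)
  qed
  \<comment> \<open>Here the first \<open>rGamma\<close> has argument 0.\<close>
  moreover have "s_cert x (n + 2) = 0"
    by (simp add: s_cert_def x_def)
  ultimately have "0 = (\<Sum>k\<le>n+1. s_cert x (Suc k) - s_cert x k)"
    using sum_lessThan_telescope[of "s_cert x" "n + 2"] by (simp add: lessThan_Suc_atMost)
  also have "\<dots> = (x + 1)^3 * real (s (n + 1))
      - (2 * x + 1) * (12 * x^2 + 12 * x + 4) * real (s n) + 16 * x^3 * real (s (n - 1))"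
  proof -
    have "real (n + 1) = x + 1" "real (n - 1) = x - 1"
      using assms by (simp_all add: x_def)
    then have "real (s (n + 1)) = (\<Sum>k\<le>n+1. s_summand (x + 1) k)"
      and "real (s n) = (\<Sum>k\<le>n+1. s_summand x k)"
      and "real (s (n - 1)) = (\<Sum>k\<le>n+1. s_summand (x - 1) k)"
      using s_eq_sum_summand[of "n + 1" "n + 1"] s_eq_sum_summand[of n "n + 1"]
        s_eq_sum_summand[of "n - 1" "n + 1"]
      by (simp_all only: x_def)
    then show ?thesis
      by (simp only: sum.distrib sum_subtractf sum_distrib_left flip: s_cert_telescopes)
  qed
  finally show ?thesis by (simp add: x_def)
qed

section \<open>The continuant transformation\<close>

text \<open>Multiplied by n!^3 / 4^(n+1), the recurrence of \<open>S\<close> becomes T(n+1) = a_n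
  T(n) - n^6 T(n-1) for T(n) = n!^3 S(n) / 4^n. The continuant at n is T(n+1), so T(0) and T(1) are
  its initial values.\<close>

lemma continuant_pcf_eqI:
  assumes rec: "\<And>n. n > 0 \<Longrightarrow> (real n + 1)^3 * S (n + 1) =
      (2 * real n + 1) * (12 * real n^2 + 12 * real n + 4) * S n - 16 * real n^3 * S (n - 1)"
    and "u = S 0" "v = S 1 / 4"
  shows "continuant pcf_a pcf_b u v n = fact (n + 1)^3 / 4^(n + 1) * S (n + 1)"
proof (induction n rule: induct_nat_012)
  case 1
  have "8 * S 2 = 84 * S 1 - 16 * S 0"
    using rec[of 1] by (simp add: numeral_2_eq_2)
  then show ?case
    by (simp add: assms(2,3) pcf_a_def pcf_b_def numeral_2_eq_2 fact_reduce)
next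
  case (ge2 n)
  define m where "m = real (n + 2)"
  have f2: "fact (n + 2) = m * (fact (n + 1) :: real)"
    and f3: "fact (n + 3) = (m + 1) * m * (fact (n + 1) :: real)"
    by (simp_all add: m_def fact_reduce algebra_simps)
  have rec': "(m + 1)^3 * S (n + 3) =
      (2 * m + 1) * (12 * m^2 + 12 * m + 4) * S (n + 2) - 16 * m^3 * S (n + 1)"
    using rec[of "n + 2"] by (simp add: m_def add.commute numeral_3_eq_3 numeral_2_eq_2)
  have "fact (n + 3)^3 / 4^(n + 3) * S (n + 3)
      = (m * fact (n + 1))^3 / (64 * 4^n) * ((m + 1)^3 * S (n + 3))"
    unfolding f3 by (simp add: power_mult_distrib power_add mult_ac del: fact_Suc)
  also have "\<dots> = pcf_a (n + 2) * (fact (n + 2)^3 / 4^(n + 2) * S (n + 2))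
      + pcf_b (n + 2) * (fact (n + 1)^3 / 4^(n + 1) * S (n + 1))"
    unfolding rec' pcf_a_def pcf_b_def f2 m_def[symmetric]
    by (simp add: field_simps del: fact_Suc)
  also have "\<dots> = continuant pcf_a pcf_b u v (Suc (Suc n))"
    using ge2 by (simp add: add.commute numeral_2_eq_2 del: fact_Suc)
  finally show ?case
    by (simp only: numeral_3_eq_3 add_Suc_right add_0_right One_nat_def)
qed (simp add: assms)

lemma P_eq: "P n = fact (n + 1)^3 / 4^(n + 1) * real (s (n + 1))"
  unfolding P_def by (rule continuant_pcf_eqI[OF s_recurrence]) (simp_all add: s_def)

lemma Q_eq: "Q n = fact (n + 1)^3 / 4^n * B8 (n + 1)"
proof -
  \<comment> \<open>Scaling \<open>B8\<close> by 4 makes the initial value \<open>S 1 / 4\<close>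
    equal to 1.\<close>
  have "Q n = fact (n + 1)^3 / 4^(n + 1) * (4 * B8 (n + 1))"
    unfolding Q_def
  proof (rule continuant_pcf_eqI)
    fix n :: nat assume "n > 0"
    then obtain m where "n = Suc m" using gr0_implies_Suc by blast
    then show "(real n + 1)^3 * (4 * B8 (n + 1)) =
      (2 * real n + 1) * (12 * real n^2 + 12 * real n + 4) * (4 * B8 n)
        - 16 * real n^3 * (4 * B8 (n - 1))"
      by (simp add: Let_def del: of_nat_Suc)
  qed simp_all
  then show ?thesis by simp
qed

section \<open>Equivalence of the two limits\<close>

lemma zeta_pos:
  assumes "x > 1"
  shows "zeta x > 0"
proof -
  have "summable (\<lambda>n. 1 / real (Suc n) powr x)"
    using assms summable_Suc_iff[of "\<lambda>n. real n powr (- x)"] summable_real_powr_iff[of "- x"]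
    by (simp add: powr_minus_divide)
  then show ?thesis
    unfolding zeta_def by (intro suminf_pos) auto
qed

theorem corollary1p2:
  shows "(\<forall>n. P n = fact (n + 1) ^ 3 / 4 ^ (n + 1) * real (s (n + 1))) \<and>
         (\<forall>n. Q n = fact (n + 1) ^ 3 / 4 ^ n * B8 (n + 1)) \<and>
         (\<forall>n. cf_convergent pcf_a pcf_b n = P n / Q n) \<and>
         (((\<lambda>n. B8 n / real (s n)) \<longlonglongrightarrow> 7 / 32 * zeta 3) \<longleftrightarrow>
          has_PCF pcf_a pcf_b (8 / (7 * zeta 3)))"
proof -
  define r where "r n = B8 n / real (s n)" for n
  define c where "c = cf_convergent pcf_a pcf_b"
  \<comment> \<open>Both candidate limits are thus nonzero, so reciprocals pass to the
    limit.\<close>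
  have z: "zeta 3 \<noteq> 0" using zeta_pos[of 3] by simp
  \<comment> \<open>The factorials cancel and the powers of 4 leave one factor 4. A zero of
    \<open>B8\<close> would make both sides 0.\<close>
  have c_eq: "c n = inverse (4 * r (Suc n))" for n
    unfolding c_def cf_convergent_pcf P_eq Q_eq r_def by (simp add: field_simps del: fact_Suc)
  have "r \<longlonglongrightarrow> 7 / 32 * zeta 3 \<longleftrightarrow> c \<longlonglongrightarrow> 8 / (7 * zeta 3)"
  proof
    assume "r \<longlonglongrightarrow> 7 / 32 * zeta 3"
    then have "(\<lambda>n. inverse (4 * r (Suc n))) \<longlonglongrightarrow> inverse (4 * (7 / 32 * zeta 3))"
      using z by (intro tendsto_intros LIMSEQ_Suc) auto
    then show "c \<longlonglongrightarrow> 8 / (7 * zeta 3)"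
      by (simp add: c_eq[abs_def] field_simps)
  next
    assume "c \<longlonglongrightarrow> 8 / (7 * zeta 3)"
    then have "(\<lambda>n. inverse (c n) / 4) \<longlonglongrightarrow> inverse (8 / (7 * zeta 3)) / 4"
      using z by (intro tendsto_intros) auto
    then have "(\<lambda>n. r (Suc n)) \<longlonglongrightarrow> 7 / 32 * zeta 3"
      by (simp only: c_eq inverse_inverse_eq) simp
    then show "r \<longlonglongrightarrow> 7 / 32 * zeta 3"
      by (rule LIMSEQ_imp_Suc)
  qed
  then show ?thesis
    using P_eq Q_eq cf_convergent_pcf by (simp add: has_PCF_def c_def r_def[abs_def])
qed

end
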